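(* Let $G$ be a finite simple graph of order $n$. For every positive integer $k$, $$\mathfrak{D}_k(G)=\sum_{i=D(G)}^{n}\binom{k}{i}\,\phi_i(G)\,|\mathrm{Aut}(G)|=\Phi_k(G)\,|\mathrm{Aut}(G)|,$$ and this is a monic polynomial in $k$ of degree $n$.
   Context: A $k$-coloring of $G$ is any map $c:V(G)\to\{1,\dots,k\}$ (not required to be surjective or proper). It is called distinguishing if the only automorphism $f$ of $G$ with $c(f(v))=c(v)$ for all $v\in V(G)$ is the identity. The distinguishing number $D(G)$ is the minimum $k$ for which a distinguishing $k$-coloring of $G$ exists. Two $k$-colorings $c,c'$ of $G$ are equivalent if there is $f\in\mathrm{Aut}(G)$ with $c'(f(v))=c(v)$ for all $v\in V(G)$. $\Phi_k(G)$ denotes the number of non-equivalent distinguishing $k$-colorings of $G$ (i.e. the number of equivalence classes of distinguishing $k$-colorings), and $\phi_k(G)$ denotes the number of non-equivalent distinguishing $k$-colorings of $G$ in which all $k$ colors are used. $\mathfrak{D}_k(G)$ denotes the number of distinguishing colorings of $G$ using at most $k$ colors, i.e. the number of distinguishing maps $c:V(G)\to\{1,\dots,k\}$. The convention $\binom{k}{i}=0$ for $i>k$ is used. *)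

theory Defs
  imports
    "Graph_Theory.Pair_Digraph"
    "HOL-Combinatorics.Permutations"
    "HOL-Computational_Algebra.Polynomial"
begin

(* A finite simple graph is a pair_graph: finitely many vertices, and the edge set is an
   irreflexive symmetric relation, an edge {u, v} being the two arcs (u, v) and (v, u). *)

(* Automorphisms are extended by the identity outside the vertex set (this is part of
   "permutes"), so that distinct functions are distinct automorphisms. *)
definition Aut :: "'a pair_pre_digraph \<Rightarrow> ('a \<Rightarrow> 'a) set" where
  "Aut G = {f. f permutes pverts G \<and>
     (\<forall>u\<in>pverts G. \<forall>v\<in>pverts G. (f u, f v) \<in> parcs G \<longleftrightarrow> (u, v) \<in> parcs G)}"

(* Extensional functions, so that colorings may be counted. *)
definition colorings :: "'a pair_pre_digraph \<Rightarrow> nat \<Rightarrow> ('a \<Rightarrow> nat) set" where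
  "colorings G k = pverts G \<rightarrow>\<^sub>E {1..k}"

definition distinguishing :: "'a pair_pre_digraph \<Rightarrow> ('a \<Rightarrow> nat) \<Rightarrow> bool" where
  "distinguishing G c \<longleftrightarrow>
     (\<forall>f\<in>Aut G. (\<forall>v\<in>pverts G. c (f v) = c v) \<longrightarrow> f = id)"

definition dist_colorings :: "'a pair_pre_digraph \<Rightarrow> nat \<Rightarrow> ('a \<Rightarrow> nat) set" where
  "dist_colorings G k = {c \<in> colorings G k. distinguishing G c}"

(* A graph with a vertex has no 0-coloring, so k = 0 only matters for the graph without
   vertices, whose distinguishing number is 0. *)
definition dist_number :: "'a pair_pre_digraph \<Rightarrow> nat" where
  "dist_number G = (LEAST k. dist_colorings G k \<noteq> {})"

definition equiv_colorings ::
    "'a pair_pre_digraph \<Rightarrow> nat \<Rightarrow> (('a \<Rightarrow> nat) \<times> ('a \<Rightarrow> nat)) set" where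
  "equiv_colorings G k = {(c, c'). c \<in> colorings G k \<and> c' \<in> colorings G k \<and>
     (\<exists>f\<in>Aut G. \<forall>v\<in>pverts G. c' (f v) = c v)}"

(* The number of distinguishing colorings with at most k colors. *)
definition num_dist :: "'a pair_pre_digraph \<Rightarrow> nat \<Rightarrow> nat" where
  "num_dist G k = card (dist_colorings G k)"

definition Phi :: "'a pair_pre_digraph \<Rightarrow> nat \<Rightarrow> nat" where
  "Phi G k = card (dist_colorings G k // equiv_colorings G k)"

definition phi :: "'a pair_pre_digraph \<Rightarrow> nat \<Rightarrow> nat" where
  "phi G k =
     card ({c \<in> dist_colorings G k. c ` pverts G = {1..k}} // equiv_colorings G k)"

lemma Aut_inv:
  assumes "f \<in> Aut G" shows "inv f \<in> Aut G"
proof -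
  have p: "f permutes pverts G" using assms by (simp add: Aut_def)
  have "(inv f u, inv f v) \<in> parcs G \<longleftrightarrow> (u, v) \<in> parcs G"
    if "u \<in> pverts G" "v \<in> pverts G" for u v
  proof -
    have "inv f u \<in> pverts G" "inv f v \<in> pverts G"
      using that permutes_in_image[OF permutes_inv[OF p]] by auto
    then have "(f (inv f u), f (inv f v)) \<in> parcs G \<longleftrightarrow> (inv f u, inv f v) \<in> parcs G"
      using assms by (simp add: Aut_def)
    then show ?thesis by (simp add: permutes_inverses[OF p])
  qed
  then show ?thesis using permutes_inv[OF p] by (simp add: Aut_def)
qed

lemma Aut_comp:
  assumes "f \<in> Aut G" "g \<in> Aut G" shows "g \<circ> f \<in> Aut G"
  using assms by (auto simp: Aut_def permutes_compose permutes_in_image)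

lemma equiv_equiv_colorings: "equiv (colorings G k) (equiv_colorings G k)"
proof (rule equivI)
  show "equiv_colorings G k \<subseteq> colorings G k \<times> colorings G k"
    by (auto simp: equiv_colorings_def)
  have "id \<in> Aut G" by (simp add: Aut_def permutes_id)
  then show "refl_on (colorings G k) (equiv_colorings G k)"
    unfolding refl_on_def equiv_colorings_def by (auto intro!: bexI[where x = id])
  show "sym (equiv_colorings G k)"
  proof (rule symI)
    fix c c' assume "(c, c') \<in> equiv_colorings G k"
    then obtain f where cc: "c \<in> colorings G k" "c' \<in> colorings G k" and f: "f \<in> Aut G"
      and eq: "\<forall>v\<in>pverts G. c' (f v) = c v" by (auto simp: equiv_colorings_def)
    have p: "f permutes pverts G" using f by (simp add: Aut_def)
    have "\<forall>v\<in>pverts G. c (inv f v) = c' v"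
      using eq permutes_in_image[OF permutes_inv[OF p]] permutes_inverses[OF p] by metis
    then show "(c', c) \<in> equiv_colorings G k"
      using cc Aut_inv[OF f] by (auto simp: equiv_colorings_def)
  qed
  show "trans (equiv_colorings G k)"
  proof (rule transI)
    fix c c' c'' assume "(c, c') \<in> equiv_colorings G k" "(c', c'') \<in> equiv_colorings G k"
    then obtain f g where cc: "c \<in> colorings G k" "c'' \<in> colorings G k"
      and f: "f \<in> Aut G" "\<forall>v\<in>pverts G. c' (f v) = c v"
      and g: "g \<in> Aut G" "\<forall>v\<in>pverts G. c'' (g v) = c' v"
      by (auto simp: equiv_colorings_def)
    have "\<forall>v\<in>pverts G. c'' ((g \<circ> f) v) = c v"
      using f g by (auto simp: Aut_def permutes_in_image)
    then show "(c, c'') \<in> equiv_colorings G k"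
      using cc Aut_comp[OF f(1) g(1)] unfolding equiv_colorings_def by blast
  qed
qed

end

theory Submission
  imports Defs
begin

text \<open>The automorphism group acts on distinguishing colorings by permuting vertices, and this action
  is free precisely because no nontrivial automorphism fixes such a coloring. So every invariant
  set of distinguishing colorings is a union of orbits of size \<open>|Aut G|\<close>. Sorting the colorings by
  the set of colors actually used turns the count into \<open>\<Sum>i. (k choose i) * s i\<close>, where \<open>s i\<close> counts
  the distinguishing colorings that use exactly \<open>i\<close> given colors. It vanishes for \<open>i > n\<close>, and
  \<open>s n = n!\<close> since injective colorings are distinguishing, so the leading term is \<open>k ^ n\<close>.\<close>

text \<open>The color set is an arbitrary \<open>T\<close>, not just \<open>{1..k}\<close>, so that
  colorings can be sorted by their image.\<close>

definition onto_dist_colorings :: "'a pair_pre_digraph \<Rightarrow> nat set \<Rightarrow> ('a \<Rightarrow> nat) set" where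
  "onto_dist_colorings G T = {c \<in> pverts G \<rightarrow>\<^sub>E T. c ` pverts G = T \<and> distinguishing G c}"

section \<open>Basic properties of distinguishing colorings\<close>

lemma finite_dist_colorings: "finite (pverts G) \<Longrightarrow> finite (dist_colorings G k)"
  unfolding dist_colorings_def colorings_def by (simp add: finite_PiE)

text \<open>Conjugation: if \<open>g\<close> preserves \<open>c'\<close>, then
  \<open>inv f \<circ> (g \<circ> f)\<close> preserves \<open>c\<close> and is therefore the
  identity, which forces \<open>g = id\<close>.\<close>

lemma distinguishing_equiv:
  assumes f: "f \<in> Aut G" and eq: "\<forall>v\<in>pverts G. c' (f v) = c v" and c: "distinguishing G c"
  shows "distinguishing G c'"
  unfolding distinguishing_def
proof (intro ballI impI)
  fix g assume g: "g \<in> Aut G" and cg: "\<forall>v\<in>pverts G. c' (g v) = c' v"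
  have pf: "f permutes pverts G" and pg: "g permutes pverts G"
    using f g by (auto simp: Aut_def)
  have "c (inv f (g (f v))) = c v" if v: "v \<in> pverts G" for v
  proof -
    have fv: "f v \<in> pverts G" using v pf by (simp add: permutes_in_image)
    then have "inv f (g (f v)) \<in> pverts G"
      using pg permutes_inv[OF pf] by (simp add: permutes_in_image)
    then have "c (inv f (g (f v))) = c' (g (f v))"
      using eq permutes_inverses(1)[OF pf] by metis
    also have "\<dots> = c v" using cg fv eq v by simp
    finally show ?thesis .
  qed
  moreover have "inv f \<circ> (g \<circ> f) \<in> Aut G"
    using f g by (intro Aut_comp Aut_inv)
  ultimately have "inv f \<circ> (g \<circ> f) = id"
    using c by (simp add: distinguishing_def)
  then have "inv f (g (f v)) = v" for v by (simp add: fun_eq_iff)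
  then have "g (f v) = f v" for v using permutes_inverses(1)[OF pf] by metis
  then show "g = id" using permutes_surj[OF pf] by (metis ext id_apply surjD)
qed

lemma inj_on_imp_distinguishing:
  assumes "inj_on c (pverts G)" shows "distinguishing G c"
  unfolding distinguishing_def
proof (intro ballI impI ext)
  fix f v assume f: "f \<in> Aut G" and eq: "\<forall>v\<in>pverts G. c (f v) = c v"
  then have p: "f permutes pverts G" by (simp add: Aut_def)
  show "f v = id v"
    using assms eq p
    by (cases "v \<in> pverts G") (auto simp: permutes_in_image permutes_not_in dest: inj_onD)
qed

section \<open>Orbits of the automorphism group\<close>

text \<open>The class of \<open>c\<close> is its orbit, and the stabilizer of \<open>c\<close> is
  trivial, so the orbit map is a bijection from \<open>Aut G\<close> onto the class.\<close>

lemma card_equiv_class: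
  assumes c: "c \<in> dist_colorings G k"
  shows "card (equiv_colorings G k `` {c}) = card (Aut G)"
proof -
  \<comment> \<open>The coloring \<open>c\<close> transported along \<open>f\<close>: the inverse
    gives \<open>h f (f v) = c v\<close>, and restricting keeps \<open>h f\<close>
    extensional.\<close>
  define h where "h f = (\<lambda>v\<in>pverts G. c (inv f v))" for f
  have cc: "c \<in> colorings G k" and dc: "distinguishing G c"
    using c by (auto simp: dist_colorings_def)
  have perm: "f permutes pverts G" if "f \<in> Aut G" for f using that by (simp add: Aut_def)
  have "h ` Aut G = equiv_colorings G k `` {c}"
  proof (intro equalityI subsetI)
    fix c' assume "c' \<in> h ` Aut G"
    then obtain f where f: "f \<in> Aut G" and c': "c' = h f" by auto
    note p = perm[OF f]
    have "c' \<in> colorings G k"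
      using cc permutes_in_image[OF permutes_inv[OF p]]
      by (auto simp: c' h_def colorings_def)
    moreover have "c' (f v) = c v" if "v \<in> pverts G" for v
      using that p by (simp add: c' h_def permutes_in_image permutes_inverses)
    ultimately show "c' \<in> equiv_colorings G k `` {c}"
      using f cc by (auto simp: equiv_colorings_def)
  next
    fix c' assume "c' \<in> equiv_colorings G k `` {c}"
    then obtain f where f: "f \<in> Aut G" and c': "c' \<in> colorings G k"
      and eq: "\<forall>v\<in>pverts G. c' (f v) = c v" by (auto simp: equiv_colorings_def)
    note p = perm[OF f]
    have "c' = h f"
    proof (rule extensionalityI[of _ "pverts G"])
      show "c' \<in> extensional (pverts G)" using c' by (auto simp: colorings_def PiE_def)
      show "h f \<in> extensional (pverts G)" by (simp add: h_def)
      fix v assume v: "v \<in> pverts G"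
      then have "inv f v \<in> pverts G" using permutes_in_image[OF permutes_inv[OF p]] by simp
      then have "c (inv f v) = c' v" using eq permutes_inverses(1)[OF p] by metis
      then show "c' v = h f v" using v by (simp add: h_def)
    qed
    then show "c' \<in> h ` Aut G" using f by blast
  qed
  moreover have "inj_on h (Aut G)"
  proof (rule inj_onI)
    fix f g assume f: "f \<in> Aut G" and g: "g \<in> Aut G" and eq: "h f = h g"
    note pf = perm[OF f] and pg = perm[OF g]
    \<comment> \<open>Evaluating \<open>h f = h g\<close> at \<open>f v\<close> shows that
      \<open>inv g \<circ> f\<close> stabilizes \<open>c\<close>.\<close>
    have "c ((inv g \<circ> f) v) = c v" if "v \<in> pverts G" for v
    proof -
      have "f v \<in> pverts G" using that pf by (simp add: permutes_in_image)
      then show ?thesis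
        using fun_cong[OF eq, of "f v"] by (simp add: h_def permutes_inverses[OF pf])
    qed
    then have "inv g \<circ> f = id"
      using dc Aut_comp[OF f Aut_inv[OF g]] by (simp add: distinguishing_def)
    then have "inv g (f v) = v" for v by (simp add: fun_eq_iff)
    then show "f = g" using permutes_inverses(1)[OF pg] by (metis ext)
  qed
  ultimately show ?thesis using card_image by metis
qed

text \<open>By \<open>closed\<close>, \<open>S\<close> is a disjoint union of whole classes, all of
  size \<open>card (Aut G)\<close>. The general \<open>S\<close> serves both \<open>Phi\<close> and
  \<open>phi\<close>.\<close>

lemma card_closed_eq_card_quotient:
  assumes fin: "finite (pverts G)" and S: "S \<subseteq> dist_colorings G k"
    and closed: "\<And>c c'. c \<in> S \<Longrightarrow> (c, c') \<in> equiv_colorings G k \<Longrightarrow> c' \<in> S"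
  shows "card S = card (S // equiv_colorings G k) * card (Aut G)"
proof -
  let ?R = "equiv_colorings G k"
  have SC: "S \<subseteq> colorings G k" using S by (auto simp: dist_colorings_def)
  have "\<Union>(S // ?R) = S"
    using closed equiv_class_self[OF equiv_equiv_colorings] SC by (fastforce simp: quotient_def)
  moreover have "finite S" using S finite_dist_colorings[OF fin] finite_subset by blast
  moreover have "card X = card (Aut G)" if "X \<in> S // ?R" for X
    using that S card_equiv_class by (auto simp: quotient_def)
  moreover have "X \<inter> Y = {}" if "X \<in> S // ?R" "Y \<in> S // ?R" "X \<noteq> Y" for X Y
  proof -
    have "S // ?R \<subseteq> colorings G k // ?R" using SC by (auto simp: quotient_def)
    then show ?thesis using that quotient_disj[OF equiv_equiv_colorings] by blast
  qed
  ultimately have "card (Aut G) * card (S // ?R) = card S"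
    using card_partition[of "S // ?R" "card (Aut G)"] by (simp add: quotient_def)
  then show ?thesis by (simp add: mult.commute)
qed

lemma num_dist_eq_Phi:
  assumes "finite (pverts G)"
  shows "num_dist G k = Phi G k * card (Aut G)"
  unfolding num_dist_def Phi_def using assms
  by (rule card_closed_eq_card_quotient)
    (auto simp: dist_colorings_def equiv_colorings_def intro: distinguishing_equiv)

text \<open>An automorphism permutes the vertices, so equivalent colorings have the same image and
  using all colors is an invariant condition.\<close>

lemma card_onto_dist_colorings_eq_phi:
  assumes fin: "finite (pverts G)"
  shows "card (onto_dist_colorings G {1..i}) = phi G i * card (Aut G)"
proof -
  have "onto_dist_colorings G {1..i} = {c \<in> dist_colorings G i. c ` pverts G = {1..i}}"
    by (auto simp: onto_dist_colorings_def dist_colorings_def colorings_def)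
  moreover have "card {c \<in> dist_colorings G i. c ` pverts G = {1..i}} = phi G i * card (Aut G)"
    unfolding phi_def
  proof (rule card_closed_eq_card_quotient[OF fin])
    fix c c' assume c: "c \<in> {c \<in> dist_colorings G i. c ` pverts G = {1..i}}"
      and "(c, c') \<in> equiv_colorings G i"
    then obtain f where f: "f \<in> Aut G" and c': "c' \<in> colorings G i"
      and eq: "\<forall>v\<in>pverts G. c' (f v) = c v" by (auto simp: equiv_colorings_def)
    have "c' ` f ` pverts G = c ` pverts G" using eq by (simp add: image_image)
    moreover have "f ` pverts G = pverts G"
      using f by (intro permutes_image) (simp add: Aut_def)
    ultimately show "c' \<in> {c \<in> dist_colorings G i. c ` pverts G = {1..i}}"
      using c c' distinguishing_equiv[OF f eq] by (auto simp: dist_colorings_def)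
  qed auto
  ultimately show ?thesis by simp
qed

section \<open>Sorting colorings by the colors used\<close>

text \<open>Renaming colors along \<open>h\<close> loses nothing: as \<open>h\<close> is injective
  on \<open>S\<close>, an automorphism preserving the renamed coloring preserves \<open>c\<close>
  itself. The reverse inequality will come from the inverse of \<open>h\<close>.\<close>

lemma card_onto_dist_colorings_le:
  assumes fin: "finite (pverts G)" and h: "bij_betw h S T"
  shows "card (onto_dist_colorings G S) \<le> card (onto_dist_colorings G T)"
proof (rule card_inj_on_le[where f = "\<lambda>c. restrict (h \<circ> c) (pverts G)"])
  have "finite (onto_dist_colorings G T)"
  proof (cases "finite T")
    case True
    then show ?thesis using fin by (simp add: onto_dist_colorings_def finite_PiE)
  next
    case False
    \<comment> \<open>Finitely many vertices cannot be mapped onto an infinite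
      \<open>T\<close>.\<close>
    then have "onto_dist_colorings G T = {}" using fin by (auto simp: onto_dist_colorings_def)
    then show ?thesis by simp
  qed
  then show "finite (onto_dist_colorings G T)" .
  have inj: "inj_on h S" and img: "h ` S = T" using h by (auto simp: bij_betw_def)
  show "inj_on (\<lambda>c. restrict (h \<circ> c) (pverts G)) (onto_dist_colorings G S)"
  proof (rule inj_onI)
    fix c d assume c: "c \<in> onto_dist_colorings G S" and d: "d \<in> onto_dist_colorings G S"
      and eq: "restrict (h \<circ> c) (pverts G) = restrict (h \<circ> d) (pverts G)"
    have c': "c \<in> pverts G \<rightarrow>\<^sub>E S" and d': "d \<in> pverts G \<rightarrow>\<^sub>E S"
      using c d by (simp_all add: onto_dist_colorings_def)
    show "c = d"
    proof (rule PiE_ext[OF c' d'])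
      fix v assume v: "v \<in> pverts G"
      then have "h (c v) = h (d v)" using fun_cong[OF eq, of v] by simp
      then show "c v = d v" using inj c' d' v by (auto dest: inj_onD)
    qed
  qed
  show "(\<lambda>c. restrict (h \<circ> c) (pverts G)) ` onto_dist_colorings G S \<subseteq> onto_dist_colorings G T"
  proof (rule image_subsetI)
    fix c assume c: "c \<in> onto_dist_colorings G S"
    have "distinguishing G (restrict (h \<circ> c) (pverts G))"
      unfolding distinguishing_def
    proof (intro ballI impI)
      fix f assume f: "f \<in> Aut G" and eq: "\<forall>v\<in>pverts G.
        restrict (h \<circ> c) (pverts G) (f v) = restrict (h \<circ> c) (pverts G) v"
      have "c (f v) = c v" if v: "v \<in> pverts G" for v
      proof -
        have fv: "f v \<in> pverts G" using f v by (simp add: Aut_def permutes_in_image)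
        then have "h (c (f v)) = h (c v)" using eq v by auto
        moreover have "c (f v) \<in> S" "c v \<in> S" using c v fv by (auto simp: onto_dist_colorings_def)
        ultimately show ?thesis using inj by (auto dest: inj_onD)
      qed
      then show "f = id" using c f by (auto simp: onto_dist_colorings_def distinguishing_def)
    qed
    moreover have "restrict (h \<circ> c) (pverts G) ` pverts G = T"
    proof -
      have "restrict (h \<circ> c) (pverts G) ` pverts G = h ` c ` pverts G" by (auto simp: image_image)
      then show ?thesis using c img by (simp add: onto_dist_colorings_def)
    qed
    ultimately show "restrict (h \<circ> c) (pverts G) \<in> onto_dist_colorings G T"
      by (auto simp: onto_dist_colorings_def)
  qed
qed

lemma card_onto_dist_colorings_cong:
  assumes "finite (pverts G)" "finite S" "finite T" "card S = card T"
  shows "card (onto_dist_colorings G S) = card (onto_dist_colorings G T)"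
proof -
  obtain h where h: "bij_betw h S T" using assms finite_same_card_bij by blast
  show ?thesis
    using card_onto_dist_colorings_le[OF assms(1) h]
      card_onto_dist_colorings_le[OF assms(1) bij_betw_inv_into[OF h]] by simp
qed

text \<open>Each coloring is counted at exactly one \<open>T\<close>, its image. There are
  \<open>k choose i\<close> sets \<open>T\<close> of size \<open>i\<close>, and by renaming all of
  them contribute equally.\<close>

lemma num_dist_eq_sum_onto:
  assumes fin: "finite (pverts G)"
  shows "num_dist G k = (\<Sum>i\<le>k. (k choose i) * card (onto_dist_colorings G {1..i}))"
proof -
  have union: "dist_colorings G k = (\<Union>T\<in>Pow {1..k}. onto_dist_colorings G T)"
    by (fastforce simp: dist_colorings_def colorings_def onto_dist_colorings_def PiE_iff)
  have "num_dist G k = (\<Sum>T\<in>Pow {1..k}. card (onto_dist_colorings G T))"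
    unfolding num_dist_def union
  proof (rule card_UN_disjoint)
    show "\<forall>T\<in>Pow {1..k}. finite (onto_dist_colorings G T)"
      using fin by (auto simp: onto_dist_colorings_def intro!: finite_PiE intro: finite_subset)
  qed (auto simp: onto_dist_colorings_def)
  also have "\<dots> = (\<Sum>i\<le>k. \<Sum>T\<in>{T \<in> Pow {1..k}. card T = i}. card (onto_dist_colorings G T))"
  proof (rule sum.group[symmetric])
    show "card ` Pow {1..k} \<subseteq> {..k}" using card_mono[of "{1..k}"] by fastforce
  qed auto
  also have "\<dots> = (\<Sum>i\<le>k. (k choose i) * card (onto_dist_colorings G {1..i}))"
  proof (rule sum.cong[OF refl])
    fix i
    have "(\<Sum>T\<in>{T \<in> Pow {1..k}. card T = i}. card (onto_dist_colorings G T))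
      = (\<Sum>T\<in>{T \<in> Pow {1..k}. card T = i}. card (onto_dist_colorings G {1..i}))"
      using fin by (intro sum.cong card_onto_dist_colorings_cong) (auto intro: finite_subset)
    also have "\<dots> = (k choose i) * card (onto_dist_colorings G {1..i})"
      using n_subsets[of "{1..k}" i] by simp
    finally show "(\<Sum>T\<in>{T \<in> Pow {1..k}. card T = i}. card (onto_dist_colorings G T))
      = (k choose i) * card (onto_dist_colorings G {1..i})" .
  qed
  finally show ?thesis .
qed

text \<open>Below \<open>dist_number G\<close> minimality excludes every distinguishing coloring;
  above the order there are too few vertices to use all the colors.\<close>

lemma onto_dist_colorings_empty:
  assumes "finite (pverts G)" and "i \<notin> {dist_number G..card (pverts G)}"
  shows "onto_dist_colorings G {1..i} = {}"
proof (cases "i < dist_number G")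
  case True
  then have "dist_colorings G i = {}" unfolding dist_number_def using not_less_Least by blast
  then show ?thesis by (auto simp: onto_dist_colorings_def dist_colorings_def colorings_def)
next
  case False
  then have "card (pverts G) < card {1..i}" using assms by auto
  then have "c ` pverts G \<noteq> {1..i}" for c :: "'a \<Rightarrow> nat"
    using card_image_le[OF assms(1), of c] by auto
  then show ?thesis by (simp add: onto_dist_colorings_def)
qed

lemma num_dist_eq_sum_phi:
  assumes fin: "finite (pverts G)"
  shows "num_dist G k =
    (\<Sum>i = dist_number G..card (pverts G). (k choose i) * phi G i * card (Aut G))"
proof -
  let ?t = "\<lambda>i. (k choose i) * card (onto_dist_colorings G {1..i})"
  have "num_dist G k = sum ?t {..k}" by (rule num_dist_eq_sum_onto[OF fin])
  \<comment> \<open>Terms only in the old range vanish since no such colorings exist, terms only in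
    the new range since \<open>k choose i = 0\<close> for \<open>i > k\<close>.\<close>
  also have "\<dots> = sum ?t {dist_number G..card (pverts G)}"
    using onto_dist_colorings_empty[OF fin]
    by (intro sum.mono_neutral_cong) (auto simp: not_le)
  finally show ?thesis
    using card_onto_dist_colorings_eq_phi[OF fin] by (simp add: mult.assoc)
qed

text \<open>Between finite sets of equal size onto means injective, and injective colorings are
  distinguishing, so this counts bijections.\<close>

lemma card_onto_dist_colorings_order:
  assumes fin: "finite (pverts G)"
  shows "card (onto_dist_colorings G {1..card (pverts G)}) = fact (card (pverts G))"
proof -
  let ?n = "card (pverts G)"
  have "onto_dist_colorings G {1..?n} = {c \<in> pverts G \<rightarrow>\<^sub>E {1..?n}. inj_on c (pverts G)}"
  proof (intro equalityI subsetI)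
    fix c assume "c \<in> onto_dist_colorings G {1..?n}"
    then show "c \<in> {c \<in> pverts G \<rightarrow>\<^sub>E {1..?n}. inj_on c (pverts G)}"
      using fin by (auto simp: onto_dist_colorings_def intro: eq_card_imp_inj_on)
  next
    fix c assume c: "c \<in> {c \<in> pverts G \<rightarrow>\<^sub>E {1..?n}. inj_on c (pverts G)}"
    then have "c ` pverts G = {1..?n}"
      by (intro card_subset_eq) (auto simp: card_image)
    then show "c \<in> onto_dist_colorings G {1..?n}"
      using c by (auto simp: onto_dist_colorings_def intro: inj_on_imp_distinguishing)
  qed
  then show ?thesis
    using card_inj_on_subset_funcset[OF fin, of "{1..?n}" "pverts G"]
    by (simp add: fact_prod_rev atLeast0LessThan)
qed

section \<open>Binomial coefficients as polynomials\<close>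

text \<open>The binomial coefficient \<open>X choose i\<close> as a polynomial in \<open>X\<close>;
  the factor \<open>1 / fact i\<close> calls for rational coefficients.\<close>

definition binomial_poly :: "nat \<Rightarrow> rat poly" where
  "binomial_poly i = smult (1 / fact i) (\<Prod>j<i. [:- of_nat j, 1:])"

lemma poly_binomial_poly: "poly (binomial_poly i) (of_nat k) = of_nat (k choose i)"
  by (simp add: binomial_poly_def poly_prod binomial_gbinomial gbinomial_prod_rev atLeast0LessThan)

lemma degree_binomial_poly: "degree (binomial_poly i) = i"
  by (simp add: binomial_poly_def degree_prod_eq_sum_degree)

lemma coeff_binomial_poly: "coeff (binomial_poly i) i = 1 / fact i"
proof -
  have "lead_coeff (binomial_poly i) = 1 / fact i"
    by (simp add: binomial_poly_def lead_coeff_prod)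
  then show ?thesis by (simp add: degree_binomial_poly)
qed

theorem theorem1p2:
  fixes G :: "'a pair_pre_digraph" and n :: nat
  assumes "pair_graph G"
    and "card (pverts G) = n"
  shows "(\<forall>k::nat. k \<ge> 1 \<longrightarrow>
            num_dist G k = (\<Sum>i = dist_number G..n. (k choose i) * phi G i * card (Aut G)) \<and>
            (\<Sum>i = dist_number G..n. (k choose i) * phi G i * card (Aut G))
              = Phi G k * card (Aut G)) \<and>
         (\<exists>p :: rat poly. lead_coeff p = 1 \<and> degree p = n \<and>
            (\<forall>k::nat. k \<ge> 1 \<longrightarrow> of_nat (num_dist G k) = poly p (of_nat k)))"
proof -
  interpret pair_graph G by fact
  have fin: "finite (pverts G)" by simp
  have sum_phi: "num_dist G k = (\<Sum>i = dist_number G..n. (k choose i) * phi G i * card (Aut G))"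
    for k using num_dist_eq_sum_phi[OF fin] assms(2) by simp
  define s where "s i = phi G i * card (Aut G)" for i
  \<comment> \<open>This factor will cancel the leading coefficient \<open>1 / fact n\<close> of
    \<open>binomial_poly n\<close>.\<close>
  have sn: "s n = fact n"
    using card_onto_dist_colorings_order[OF fin] card_onto_dist_colorings_eq_phi[OF fin] assms(2)
    by (simp add: s_def)
  \<comment> \<open>Leads to \<open>dist_number G \<le> n\<close>, which ensures that the index
    \<open>n\<close> occurs in the sum defining \<open>p\<close>.\<close>
  have "onto_dist_colorings G {1..n} \<noteq> {}"
    using card_onto_dist_colorings_order[OF fin] assms(2) by auto
  then have D: "dist_number G \<le> n"
    using onto_dist_colorings_empty[OF fin, of n] assms(2) by fastforce
  define p :: "rat poly"
    where "p = (\<Sum>i = dist_number G..n. smult (of_nat (s i)) (binomial_poly i))"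
  have le: "degree p \<le> n"
    unfolding p_def
    by (intro degree_sum_le order_trans[OF degree_smult_le]) (auto simp: degree_binomial_poly)
  \<comment> \<open>For \<open>i < n\<close> the summand has degree below \<open>n\<close>, so only
    \<open>i = n\<close> contributes.\<close>
  have "coeff p n = (\<Sum>i = dist_number G..n. if i = n then 1 else 0)"
    unfolding p_def coeff_sum
    by (intro sum.cong) (auto simp: coeff_binomial_poly sn coeff_eq_0 degree_binomial_poly)
  then have lead: "coeff p n = 1" using D by simp
  then have deg: "degree p = n" using le le_degree[of p n] by simp
  have "of_nat (num_dist G k) = poly p (of_nat k)" for k
    by (simp add: sum_phi p_def poly_sum poly_binomial_poly s_def mult_ac)
  then show ?thesis
    using sum_phi num_dist_eq_Phi[OF fin] lead deg by (metis (no_types, lifting))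
qed

end
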